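(* Let $\varepsilon>0$ and $A=\begin{bmatrix}\lambda_1 & z\\ 0&\lambda_2\end{bmatrix}$ with $\lambda_1,\lambda_2,z\in\mathbb{C}$, viewed as a bounded right $\mathbb{H}$-linear operator on $\mathbb{H}^2$. Then $$\Lambda_\varepsilon^S(A)=\Big\{q\in\mathbb{H}:\ \sqrt{|Q_q(\lambda_1)|^2+|Q_q(\lambda_2)|^2+|(\lambda_1+\lambda_2)z-2\mathrm{Re}(q)z|^2+2|Q_q(\lambda_1)||Q_q(\lambda_2)|}$$ $$\qquad-\sqrt{|Q_q(\lambda_1)|^2+|Q_q(\lambda_2)|^2+|(\lambda_1+\lambda_2)z-2\mathrm{Re}(q)z|^2-2|Q_q(\lambda_1)||Q_q(\lambda_2)|}\ \le 2\varepsilon\Big\},$$ where $Q_q(\lambda)=\lambda^2-2\mathrm{Re}(q)\lambda+|q|^2$ for $\lambda\in\mathbb{C}$.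
   Context: $\mathbb{H}$ is the division ring of real quaternions, with $\mathbb{C}=\mathbb{R}+\mathbb{R}i\subset\mathbb{H}$; $\mathrm{Re}(q)$ and $|q|$ denote the real part and modulus of $q\in\mathbb{H}$. $\mathbb{H}^2$ is the right quaternionic Hilbert space with inner product $\langle x,y\rangle=\overline{x_1}y_1+\overline{x_2}y_2$, and a matrix in $M_2(\mathbb{H})$ acts on column vectors by left multiplication; norms of operators are operator norms. For a bounded right $\mathbb{H}$-linear operator $T$ and $q\in\mathbb{H}$ put $Q_q(T)=T^2-2\,\mathrm{Re}(q)T+|q|^2I$. The $S$-spectrum is $\sigma_S(T)=\{q\in\mathbb{H}: Q_q(T)\text{ is not invertible}\}$. For $\varepsilon>0$ the pseudo $S$-spectrum is $\Lambda_\varepsilon^S(T)=\sigma_S(T)\cup\{q\in\mathbb{H}\setminus\sigma_S(T): \|Q_q(T)^{-1}\|\ge 1/\varepsilon\}$. *)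

theory Defs
  imports "HOL-Analysis.Analysis"
begin

section \<open>The division ring of real quaternions\<close>

text \<open>The quaternion \<open>a + b i + c j + d k\<close> is \<open>Quat a b c d\<close>.\<close>

datatype quat = Quat (qRe: real) (qI: real) (qJ: real) (qK: real)

lemma quat_eq_iff: "p = q \<longleftrightarrow> qRe p = qRe q \<and> qI p = qI q \<and> qJ p = qJ q \<and> qK p = qK q"
  by (cases p; cases q) auto

instantiation quat :: ab_group_add
begin

definition "0 = Quat 0 0 0 0"
definition "p + q = Quat (qRe p + qRe q) (qI p + qI q) (qJ p + qJ q) (qK p + qK q)"
definition "p - q = Quat (qRe p - qRe q) (qI p - qI q) (qJ p - qJ q) (qK p - qK q)"
definition "- q = Quat (- qRe q) (- qI q) (- qJ q) (- qK q)"

instance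
  by standard (simp_all add: quat_eq_iff zero_quat_def plus_quat_def minus_quat_def uminus_quat_def)

end

lemma quat_zero_sel [simp]: "qRe 0 = 0" "qI 0 = 0" "qJ 0 = 0" "qK 0 = 0"
  by (simp_all add: zero_quat_def)

lemma quat_add_sel [simp]:
  "qRe (p + q) = qRe p + qRe q" "qI (p + q) = qI p + qI q"
  "qJ (p + q) = qJ p + qJ q" "qK (p + q) = qK p + qK q"
  by (simp_all add: plus_quat_def)

lemma quat_diff_sel [simp]:
  "qRe (p - q) = qRe p - qRe q" "qI (p - q) = qI p - qI q"
  "qJ (p - q) = qJ p - qJ q" "qK (p - q) = qK p - qK q"
  by (simp_all add: minus_quat_def)

lemma quat_uminus_sel [simp]:
  "qRe (- q) = - qRe q" "qI (- q) = - qI q" "qJ (- q) = - qJ q" "qK (- q) = - qK q"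
  by (simp_all add: uminus_quat_def)

definition qcnj :: "quat \<Rightarrow> quat" where
  "qcnj q = Quat (qRe q) (- qI q) (- qJ q) (- qK q)"

lemma qcnj_sel [simp]:
  "qRe (qcnj q) = qRe q" "qI (qcnj q) = - qI q" "qJ (qcnj q) = - qJ q" "qK (qcnj q) = - qK q"
  by (simp_all add: qcnj_def)

instantiation quat :: real_vector
begin

definition "r *\<^sub>R q = Quat (r * qRe q) (r * qI q) (r * qJ q) (r * qK q)"

instance
  by standard (simp_all add: quat_eq_iff scaleR_quat_def algebra_simps)

end

lemma quat_scaleR_sel [simp]:
  "qRe (r *\<^sub>R q) = r * qRe q" "qI (r *\<^sub>R q) = r * qI q"
  "qJ (r *\<^sub>R q) = r * qJ q" "qK (r *\<^sub>R q) = r * qK q"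
  by (simp_all add: scaleR_quat_def)

instantiation quat :: real_inner
begin

definition "inner_quat p q = qRe p * qRe q + qI p * qI q + qJ p * qJ q + qK p * qK q"
definition "norm_quat q = sqrt ((qRe q)\<^sup>2 + (qI q)\<^sup>2 + (qJ q)\<^sup>2 + (qK q)\<^sup>2)"
definition "sgn_quat (q :: quat) = q /\<^sub>R norm q"
definition "dist_quat p q = norm (p - q :: quat)"
definition [code del]:
  "(uniformity :: (quat \<times> quat) filter) = (INF e\<in>{0 <..}. principal {(x, y). dist x y < e})"
definition [code del]:
  "open (U :: quat set) \<longleftrightarrow>
    (\<forall>x\<in>U. eventually (\<lambda>(x', y). x' = x \<longrightarrow> y \<in> U) uniformity)"

instance
proof
  fix p q r :: quat and a :: real
  show "dist p q = norm (p - q)" by (rule dist_quat_def)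
  show "sgn p = p /\<^sub>R norm p" by (rule sgn_quat_def)
  show "(uniformity :: (quat \<times> quat) filter) =
      (INF e\<in>{0 <..}. principal {(x, y). dist x y < e})"
    by (rule uniformity_quat_def)
  show "open U \<longleftrightarrow> (\<forall>x\<in>U. eventually (\<lambda>(x', y). x' = x \<longrightarrow> y \<in> U) uniformity)"
    for U :: "quat set"
    by (rule open_quat_def)
  show "inner p q = inner q p" by (simp add: inner_quat_def)
  show "inner (p + q) r = inner p r + inner q r" by (simp add: inner_quat_def algebra_simps)
  show "inner (a *\<^sub>R p) q = a * inner p q" by (simp add: inner_quat_def algebra_simps)
  show "0 \<le> inner p p" by (simp add: inner_quat_def)
  show "inner p p = 0 \<longleftrightarrow> p = 0"
    by (auto simp add: inner_quat_def quat_eq_iff add_nonneg_eq_0_iff)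
  show "norm p = sqrt (inner p p)"
    by (simp add: inner_quat_def norm_quat_def power2_eq_square)
qed

end

lemma norm_quat_power2: "(norm q)\<^sup>2 = (qRe q)\<^sup>2 + (qI q)\<^sup>2 + (qJ q)\<^sup>2 + (qK q)\<^sup>2"
  by (simp add: norm_quat_def)

text \<open>The product is Hamilton's, determined by \<open>i\<^sup>2 = j\<^sup>2 = k\<^sup>2 = i j k = -1\<close>.\<close>

instantiation quat :: real_normed_div_algebra
begin

definition "1 = Quat 1 0 0 0"
definition "p * q = Quat
  (qRe p * qRe q - qI p * qI q - qJ p * qJ q - qK p * qK q)
  (qRe p * qI q + qI p * qRe q + qJ p * qK q - qK p * qJ q)
  (qRe p * qJ q - qI p * qK q + qJ p * qRe q + qK p * qI q)
  (qRe p * qK q + qI p * qJ q - qJ p * qI q + qK p * qRe q)"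
definition "inverse (q :: quat) = qcnj q /\<^sub>R (norm q)\<^sup>2"
definition "p div (q :: quat) = p * inverse q"

instance
proof
  fix p q r :: quat and a :: real
  show "p * q * r = p * (q * r)" "(p + q) * r = p * r + q * r" "p * (q + r) = p * q + p * r"
    "a *\<^sub>R p * q = a *\<^sub>R (p * q)" "p * a *\<^sub>R q = a *\<^sub>R (p * q)"
    by (simp_all add: quat_eq_iff times_quat_def algebra_simps)
  show "1 * p = p" "p * 1 = p" "(0 :: quat) \<noteq> 1"
    by (simp_all add: quat_eq_iff times_quat_def one_quat_def)
  show "p div q = p * inverse q" by (rule divide_quat_def)
  show "inverse (0 :: quat) = 0" by (simp add: inverse_quat_def quat_eq_iff)
  have *: "(norm p)\<^sup>2 = qRe p * qRe p + qI p * qI p + qJ p * qJ p + qK p * qK p"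
    unfolding norm_quat_power2 by (simp add: power2_eq_square)
  have cnj: "qcnj p * p = (norm p)\<^sup>2 *\<^sub>R 1" "p * qcnj p = (norm p)\<^sup>2 *\<^sub>R 1"
    unfolding * by (simp_all add: quat_eq_iff times_quat_def one_quat_def algebra_simps)
  have left: "a *\<^sub>R p * q = a *\<^sub>R (p * q)" and right: "p * a *\<^sub>R q = a *\<^sub>R (p * q)"
    for a p and q :: quat
    by (simp_all add: quat_eq_iff times_quat_def algebra_simps)
  show "inverse p * p = 1" "p * inverse p = 1" if "p \<noteq> 0"
    using that by (simp_all add: inverse_quat_def left right cnj)
  have "(norm (p * q))\<^sup>2 = (norm p * norm q)\<^sup>2"
    unfolding power_mult_distrib norm_quat_power2
    by (simp add: times_quat_def power2_eq_square algebra_simps)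
  then show "norm (p * q) = norm p * norm q"
    by (simp add: power2_eq_iff_nonneg)
qed

end

lemma quat_unit_relations:
  "Quat 0 1 0 0 * Quat 0 1 0 0 = - 1" "Quat 0 0 1 0 * Quat 0 0 1 0 = - 1"
  "Quat 0 0 0 1 * Quat 0 0 0 1 = - 1" "Quat 0 1 0 0 * Quat 0 0 1 0 = Quat 0 0 0 1"
  by (simp_all add: quat_eq_iff times_quat_def one_quat_def)

text \<open>The embedding of the complex numbers as \<open>\<real> + \<real> i\<close>.\<close>

definition quat_of_complex :: "complex \<Rightarrow> quat" where
  "quat_of_complex z = Quat (Re z) (Im z) 0 0"

lemma quat_of_complex_hom:
  "quat_of_complex (w + z) = quat_of_complex w + quat_of_complex z"
  "quat_of_complex (w * z) = quat_of_complex w * quat_of_complex z"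
  "quat_of_complex 1 = 1"
  "norm (quat_of_complex z) = cmod z"
  by (simp_all add: quat_of_complex_def quat_eq_iff times_quat_def one_quat_def
      norm_quat_def cmod_def)


section \<open>Right-linear operators on quaternionic column vectors\<close>

definition right_scale :: "quat ^ 'n \<Rightarrow> quat \<Rightarrow> quat ^ 'n" where
  "right_scale x c = (\<chi> i. x $ i * c)"

definition qinner :: "quat ^ 'n \<Rightarrow> quat ^ 'n \<Rightarrow> quat" where
  "qinner x y = (\<Sum>i\<in>UNIV. qcnj (x $ i) * y $ i)"

text \<open>The library norm of \<open>quat ^ 'n\<close> is the one induced by the quaternionic inner product, so
  \<open>onorm\<close> below is the operator norm of the right quaternionic Hilbert space.\<close>

lemma qinner_self: "qinner x x = of_real ((norm x)\<^sup>2)"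
proof -
  have "qcnj p * p = of_real ((norm p)\<^sup>2)" for p :: quat
    by (simp only: of_real_def norm_quat_power2)
      (simp add: quat_eq_iff times_quat_def one_quat_def power2_eq_square algebra_simps)
  then have "qinner x x = of_real (\<Sum>i\<in>UNIV. (norm (x $ i))\<^sup>2)"
    by (simp add: qinner_def)
  also have "(\<Sum>i\<in>UNIV. (norm (x $ i))\<^sup>2) = (norm x)\<^sup>2"
    by (simp add: norm_vec_def L2_set_def sum_nonneg)
  finally show ?thesis .
qed

definition bounded_right_linear :: "(quat ^ 'n \<Rightarrow> quat ^ 'n) \<Rightarrow> bool" where
  "bounded_right_linear T \<longleftrightarrow>
    bounded_linear T \<and> (\<forall>x c. T (right_scale x c) = right_scale (T x) c)"

lemma bounded_right_linear_matrix:
  fixes A :: "quat ^ 'n ^ 'n"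
  shows "bounded_right_linear ((*v) A)"
proof -
  let ?K = "\<Sum>i\<in>UNIV. \<Sum>j\<in>UNIV. norm (A $ i $ j)"
  have "bounded_linear ((*v) A)"
  proof (rule bounded_linear_intro)
    fix x y :: "quat ^ 'n" and r :: real
    show "A *v (x + y) = A *v x + A *v y"
      by (rule matrix_vector_right_distrib)
    show "A *v (r *\<^sub>R x) = r *\<^sub>R (A *v x)"
      by (simp add: vec_eq_iff matrix_vector_mult_def scaleR_sum_right)
    have "norm (A *v x) \<le> (\<Sum>i\<in>UNIV. norm ((A *v x) $ i))"
      by (simp add: norm_vec_def L2_set_le_sum)
    also have "\<dots> \<le> (\<Sum>i\<in>UNIV. \<Sum>j\<in>UNIV. norm (A $ i $ j) * norm x)"
      unfolding matrix_vector_mult_def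
      by (auto intro!: sum_mono sum_norm_le mult_left_mono Finite_Cartesian_Product.norm_nth_le simp: norm_mult)
    finally show "norm (A *v x) \<le> norm x * ?K"
      by (simp add: sum_distrib_left mult.commute)
  qed
  moreover have "A *v right_scale x c = right_scale (A *v x) c" for x c
    by (simp add: matrix_vector_mult_def right_scale_def sum_distrib_right mult.assoc)
  ultimately show ?thesis
    by (simp add: bounded_right_linear_def)
qed

text \<open>Invertibility in the algebra of bounded right-linear operators; for such \<open>T\<close> the inverse
  operator is \<open>inv T\<close>.\<close>

definition invertible_op :: "(quat ^ 'n \<Rightarrow> quat ^ 'n) \<Rightarrow> bool" where
  "invertible_op T \<longleftrightarrow> (\<exists>S. bounded_right_linear S \<and> S \<circ> T = id \<and> T \<circ> S = id)"

definition Q_op :: "quat \<Rightarrow> (quat ^ 'n \<Rightarrow> quat ^ 'n) \<Rightarrow> quat ^ 'n \<Rightarrow> quat ^ 'n" where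
  "Q_op q T = (\<lambda>x. T (T x) - (2 * qRe q) *\<^sub>R T x + (norm q)\<^sup>2 *\<^sub>R x)"

definition S_spectrum :: "(quat ^ 'n \<Rightarrow> quat ^ 'n) \<Rightarrow> quat set" where
  "S_spectrum T = {q. \<not> invertible_op (Q_op q T)}"

definition pseudo_S_spectrum :: "real \<Rightarrow> (quat ^ 'n \<Rightarrow> quat ^ 'n) \<Rightarrow> quat set" where
  "pseudo_S_spectrum \<epsilon> T =
    S_spectrum T \<union> {q. q \<notin> S_spectrum T \<and> onorm (inv (Q_op q T)) \<ge> 1 / \<epsilon>}"

definition Q_complex :: "quat \<Rightarrow> complex \<Rightarrow> complex" where
  "Q_complex q w = w\<^sup>2 - 2 * of_real (qRe q) * w + of_real ((norm q)\<^sup>2)"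

end

theory Submission
  imports Defs
begin

text \<open>For \<open>A\<close> upper triangular with complex entries, \<open>Q\<^sub>q(A)\<close> is again upper triangular, and
  \<open>\<parallel>Q\<^sub>q(A)\<^sup>-\<^sup>1\<parallel>\<close> is the reciprocal of its smallest singular value \<open>s\<close>. The two singular values have
  product \<open>p = |Q\<^sub>q(\<lambda>\<^sub>1)| |Q\<^sub>q(\<lambda>\<^sub>2)|\<close> and their squares have sum \<open>F\<close>, the squared
  Hilbert-Schmidt norm, so their sum and difference are the square roots of \<open>F + 2 p\<close> and
  \<open>F - 2 p\<close>; hence the difference of these roots is \<open>2 s\<close>.\<close>

definition upper_tri :: "quat \<Rightarrow> quat \<Rightarrow> quat \<Rightarrow> quat ^ 2 ^ 2" where
  "upper_tri a b d = vector [vector [a, b], vector [0, d]]"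

lemma upper_tri_mult [simp]:
  "(upper_tri a b d *v x) $ 1 = a * x $ 1 + b * x $ 2"
  "(upper_tri a b d *v x) $ 2 = d * x $ 2"
  by (simp_all add: upper_tri_def matrix_vector_mult_def sum_2)

lemma norm_vec2_power2:
  fixes x :: "'a::real_normed_vector ^ 2"
  shows "(norm x)\<^sup>2 = (norm (x $ 1))\<^sup>2 + (norm (x $ 2))\<^sup>2"
  by (simp add: norm_vec_def L2_set_def sum_2)

text \<open>The corner entry of the square is \<open>l1 * z + z * l2\<close>. It becomes
  \<open>(l1 + l2) * z\<close> because all entries lie in the commutative subfield of complex
  numbers.\<close>

lemma Q_op_upper_tri:
  "Q_op q ((*v) (upper_tri (quat_of_complex l1) (quat_of_complex z) (quat_of_complex l2))) =
   (*v) (upper_tri (quat_of_complex (Q_complex q l1))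
          (quat_of_complex ((l1 + l2) * z - 2 * of_real (qRe q) * z))
          (quat_of_complex (Q_complex q l2)))"
proof -
  have Q: "quat_of_complex (Q_complex q w) = quat_of_complex w * quat_of_complex w
      - (2 * qRe q) *\<^sub>R quat_of_complex w + (norm q)\<^sup>2 *\<^sub>R 1" for w
    by (simp add: quat_eq_iff quat_of_complex_def Q_complex_def times_quat_def one_quat_def
        power2_eq_square)
  have b: "quat_of_complex ((l1 + l2) * z - 2 * of_real (qRe q) * z) =
      quat_of_complex l1 * quat_of_complex z + quat_of_complex z * quat_of_complex l2
      - (2 * qRe q) *\<^sub>R quat_of_complex z"
    by (simp add: quat_eq_iff quat_of_complex_def times_quat_def algebra_simps)
  show ?thesis
    unfolding Q b by (simp add: fun_eq_iff vec_eq_iff forall_2 Q_op_def algebra_simps)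
qed

text \<open>\<open>S\<close> is back substitution: solve the second row for the second coordinate,
  then the first row. The order of the factors matters, since the entries need not commute.\<close>

lemma invertible_op_upper_tri:
  fixes a b d :: quat
  assumes "a \<noteq> 0" "d \<noteq> 0"
  defines "S \<equiv> (*v) (upper_tri (inverse a) (- inverse a * b * inverse d) (inverse d))"
  shows "invertible_op ((*v) (upper_tri a b d))" and "inv ((*v) (upper_tri a b d)) = S"
proof -
  have cancel: "inverse a * (a * x) = x" "a * (inverse a * x) = x"
    "inverse d * (d * x) = x" "d * (inverse d * x) = x" for x
    using assms(1,2) by (simp_all flip: mult.assoc)
  have ST: "S \<circ> (*v) (upper_tri a b d) = id" and TS: "(*v) (upper_tri a b d) \<circ> S = id"
    by (simp_all add: S_def fun_eq_iff vec_eq_iff forall_2 distrib_left right_diff_distrib mult.assoc cancel)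
  show "invertible_op ((*v) (upper_tri a b d))"
    unfolding invertible_op_def using ST TS bounded_right_linear_matrix S_def by blast
  show "inv ((*v) (upper_tri a b d)) = S"
    using TS ST by (rule inv_unique_comp)
qed

text \<open>If \<open>a = 0\<close>, the first basis vector lies in the kernel; if
  \<open>d = 0\<close>, the second basis vector is missed by the range.\<close>

lemma not_invertible_op_upper_tri:
  assumes "a = 0 \<or> d = 0"
  shows "\<not> invertible_op ((*v) (upper_tri a b d))"
proof
  assume "invertible_op ((*v) (upper_tri a b d))"
  then obtain S where S: "S \<circ> (*v) (upper_tri a b d) = id" "(*v) (upper_tri a b d) \<circ> S = id"
    by (auto simp: invertible_op_def)
  have "inj ((*v) (upper_tri a b d))" "surj ((*v) (upper_tri a b d))"
    by (metis S(1) inj_on_id inj_on_imageI2, metis S(2) fun.set_map image_comp comp_apply id_apply surjI)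
  from assms show False
  proof
    assume "a = 0"
    then have "upper_tri a b d *v vector [1, 0] = upper_tri a b d *v 0"
      by (simp add: vec_eq_iff forall_2)
    with \<open>inj _\<close> have "vector [1, 0] = (0 :: quat ^ 2)"
      by (rule injD)
    then show False
      by (simp add: vec_eq_iff forall_2)
  next
    assume "d = 0"
    obtain x where "vector [0, 1] = upper_tri a b d *v x"
      using \<open>surj _\<close> by blast
    with \<open>d = 0\<close> show False
      by (simp add: vec_eq_iff forall_2)
  qed
qed

text \<open>With \<open>M = upper_tri a b d\<close>, \<open>char_poly\<close> says that the
  Hermitian matrix \<open>M\<^sup>* M - s\<^sup>2 I\<close> is singular: its diagonal entries are
  the two factors on the left, and its corner entries have modulus |a| |b|.\<close>

context
  fixes a b d :: quat and s :: real
  assumes char_poly: "((norm a)\<^sup>2 - s\<^sup>2) * ((norm b)\<^sup>2 + (norm d)\<^sup>2 - s\<^sup>2) = (norm a * norm b)\<^sup>2"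
begin

text \<open>The bound on \<open>2 * s\<^sup>2\<close> by the trace of \<open>M\<^sup>* M\<close>
  selects the smaller singular value. It makes both diagonal entries of
  \<open>M\<^sup>* M - s\<^sup>2 I\<close> nonnegative, so this matrix is positive
  semidefinite.\<close>

lemma upper_tri_norm_ge:
  assumes "2 * s\<^sup>2 \<le> (norm a)\<^sup>2 + (norm b)\<^sup>2 + (norm d)\<^sup>2" "s \<ge> 0"
  shows "s * norm x \<le> norm (upper_tri a b d *v x)"
proof -
  define \<alpha> \<gamma> where "\<alpha> = (norm a)\<^sup>2 - s\<^sup>2" and "\<gamma> = (norm b)\<^sup>2 + (norm d)\<^sup>2 - s\<^sup>2"
  define u v where "u = norm (x $ 1)" and "v = norm (x $ 2)"
  have det: "\<alpha> * \<gamma> = (norm a * norm b)\<^sup>2"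
    using char_poly by (simp add: \<alpha>_def \<gamma>_def)
  have "\<alpha> + \<gamma> \<ge> 0"
    using assms by (simp add: \<alpha>_def \<gamma>_def)
  moreover have "\<alpha> * \<gamma> \<ge> 0"
    by (simp add: det)
  ultimately have nonneg: "\<alpha> \<ge> 0" "\<gamma> \<ge> 0"
    by (auto simp: zero_le_mult_iff)
  \<comment> \<open>The vanishing determinant turns the quadratic form in the moduli
    \<open>u\<close> and \<open>v\<close> into a perfect square.\<close>
  have "sqrt \<alpha> * sqrt \<gamma> = norm a * norm b"
    by (simp add: det flip: real_sqrt_mult)
  then have "\<alpha> * u\<^sup>2 - 2 * (norm a * norm b) * (u * v) + \<gamma> * v\<^sup>2 = (sqrt \<alpha> * u - sqrt \<gamma> * v)\<^sup>2"
    using nonneg by (simp add: power2_diff power_mult_distrib algebra_simps)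
  then have form: "0 \<le> \<alpha> * u\<^sup>2 - 2 * (norm a * norm b) * (u * v) + \<gamma> * v\<^sup>2"
    by simp
  \<comment> \<open>The reverse triangle inequality replaces the quaternionic cross term by its
    worst case, leaving only moduli.\<close>
  have "\<bar>norm (a * x $ 1) - norm (b * x $ 2)\<bar> \<le> norm (a * x $ 1 + b * x $ 2)"
    using norm_triangle_ineq3[of "a * x $ 1" "- (b * x $ 2)"] by simp
  then have "(norm a * u - norm b * v)\<^sup>2 \<le> (norm (a * x $ 1 + b * x $ 2))\<^sup>2"
    by (metis abs_le_square_iff abs_norm_cancel norm_mult u_def v_def)
  then have "(s * norm x)\<^sup>2 \<le> (norm (upper_tri a b d *v x))\<^sup>2"
    using form
    by (simp add: norm_vec2_power2 power_mult_distrib norm_mult \<alpha>_def \<gamma>_def u_def [symmetric]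
        v_def [symmetric] power2_diff algebra_simps)
  then show ?thesis
    by (rule power2_le_imp_le) simp
qed

lemma upper_tri_norm_attained:
  assumes "a \<noteq> 0"
  obtains x where "x \<noteq> 0" "(norm (upper_tri a b d *v x))\<^sup>2 = (s * norm x)\<^sup>2"
proof -
  define \<alpha> where "\<alpha> = (norm a)\<^sup>2 - s\<^sup>2"
  show ?thesis
  proof (cases "\<alpha> = 0")
    \<comment> \<open>Here \<open>char_poly\<close> and \<open>a \<noteq> 0\<close> force
      \<open>b = 0\<close>, so the kernel vector of the other case would be zero. The first basis
      vector serves instead.\<close>
    case True
    show ?thesis
    proof (rule that)
      show "vector [1, 0] \<noteq> (0 :: quat ^ 2)"
        by (simp add: vec_eq_iff forall_2)
      show "(norm (upper_tri a b d *v vector [1, 0]))\<^sup>2 = (s * norm (vector [1, 0] :: quat ^ 2))\<^sup>2"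
        using True by (simp add: norm_vec2_power2 power_mult_distrib \<alpha>_def)
    qed
  next
    case False
    \<comment> \<open>\<open>x\<close> spans the kernel of the singular matrix \<open>M\<^sup>* M - s\<^sup>2 I\<close>, where \<open>M = upper_tri a b d\<close>.\<close>
    define x :: "quat ^ 2" where "x = vector [- (qcnj a * b), of_real \<alpha>]"
    have cnj: "a * qcnj a = of_real ((norm a)\<^sup>2)" "norm (qcnj a) = norm a"
      by (simp only: of_real_def norm_quat_power2)
        (simp_all add: quat_eq_iff times_quat_def one_quat_def norm_quat_def power2_eq_square)
    have "a * (qcnj a * b) = (norm a)\<^sup>2 *\<^sub>R b"
      by (metis cnj(1) mult.assoc scaleR_conv_of_real)
    moreover have "b * of_real \<alpha> = \<alpha> *\<^sub>R b"
      by (simp add: of_real_def)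
    ultimately have "a * x $ 1 + b * x $ 2 = (- s\<^sup>2) *\<^sub>R b"
      by (simp add: x_def \<alpha>_def algebra_simps)
    then have "(norm (upper_tri a b d *v x))\<^sup>2 = s ^ 4 * (norm b)\<^sup>2 + (norm d)\<^sup>2 * \<alpha>\<^sup>2"
      by (simp add: norm_vec2_power2 power_mult_distrib norm_mult x_def flip: power_mult)
    \<comment> \<open>From \<open>char_poly\<close>, |d|^2 \<alpha> = s^2 (|b|^2 +
      \<alpha>).\<close>
    also have "\<dots> = s\<^sup>2 * ((norm a)\<^sup>2 * (norm b)\<^sup>2 + \<alpha>\<^sup>2)"
      using char_poly unfolding \<alpha>_def by algebra
    also have "\<dots> = (s * norm x)\<^sup>2"
      by (simp add: norm_vec2_power2 power_mult_distrib norm_mult x_def cnj)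
    finally have "(norm (upper_tri a b d *v x))\<^sup>2 = (s * norm x)\<^sup>2" .
    moreover have "x \<noteq> 0"
      using False by (simp add: x_def vec_eq_iff forall_2)
    ultimately show ?thesis
      using that by blast
  qed
qed

text \<open>The lower bound on \<open>upper_tri a b d\<close>, applied to preimages, bounds the
  inverse from above; the image of an extremal vector shows that the bound is attained.\<close>

lemma onorm_inv_upper_tri:
  assumes "a \<noteq> 0" "d \<noteq> 0" "s > 0" "2 * s\<^sup>2 \<le> (norm a)\<^sup>2 + (norm b)\<^sup>2 + (norm d)\<^sup>2"
  shows "onorm (inv ((*v) (upper_tri a b d))) = 1 / s"
proof (rule antisym)
  let ?T = "(*v) (upper_tri a b d)"
  have bl: "bounded_linear (inv ?T)"
    using bounded_right_linear_matrix
    by (auto simp: invertible_op_upper_tri(2) assms bounded_right_linear_def)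
  have bij: "bij ?T"
    using invertible_op_upper_tri(1)[OF assms(1,2)]
    by (auto simp: invertible_op_def intro: o_bij)
  show "onorm (inv ?T) \<le> 1 / s"
  proof (rule onorm_le)
    fix y
    have "s * norm (inv ?T y) \<le> norm (?T (inv ?T y))"
      using assms by (intro upper_tri_norm_ge) auto
    also have "?T (inv ?T y) = y"
      using bij by (simp add: bij_is_surj surj_f_inv_f)
    finally show "norm (inv ?T y) \<le> 1 / s * norm y"
      using assms by (simp add: field_simps)
  qed
  obtain x where x: "x \<noteq> 0" "(norm (?T x))\<^sup>2 = (s * norm x)\<^sup>2"
    using upper_tri_norm_attained[OF assms(1)] .
  then have "norm (?T x) = s * norm x"
    using assms by (simp add: power2_eq_iff_nonneg)
  then have "norm (inv ?T (?T x)) \<le> onorm (inv ?T) * (s * norm x)"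
    using onorm[OF bl, of "?T x"] by simp
  then show "1 / s \<le> onorm (inv ?T)"
    using x bij assms by (simp add: bij_is_inj field_simps)
qed

end

lemma smallest_singular_value:
  fixes x y w :: real
  assumes "x > 0" "y > 0" and F: "F = x\<^sup>2 + y\<^sup>2 + w\<^sup>2"
    and s: "2 * s = sqrt (F + 2 * x * y) - sqrt (F - 2 * x * y)"
  shows "s > 0" "2 * s\<^sup>2 \<le> F" "(x\<^sup>2 - s\<^sup>2) * (w\<^sup>2 + y\<^sup>2 - s\<^sup>2) = (x * w)\<^sup>2"
proof -
  define m n where "m = sqrt (F + 2 * x * y)" and "n = sqrt (F - 2 * x * y)"
  have xy: "x * y > 0" using assms by simp
  \<comment> \<open>Writing the second radicand as a sum of squares shows that its root is
    genuine.\<close>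
  have "F - 2 * x * y = (x - y)\<^sup>2 + w\<^sup>2"
    by (simp add: F power2_diff)
  then have ge: "F - 2 * x * y \<ge> 0" by simp
  then have m: "m\<^sup>2 = F + 2 * x * y" and n: "n\<^sup>2 = F - 2 * x * y"
    using xy by (simp_all add: m_def n_def)
  have s2: "2 * s = m - n" using s by (simp add: m_def n_def)
  have "n < m" unfolding m_def n_def using xy by (intro real_sqrt_less_mono) simp
  then show "s > 0" using s2 by simp
  have "m * n \<ge> 0" using ge xy by (simp add: m_def n_def)
  \<comment> \<open>Expand (m - n)^2 = 4 s^2 and use m^2 + n^2 = 2 F.\<close>
  moreover have eq: "F - 2 * s\<^sup>2 = m * n"
    using m n s2 by algebra
  ultimately show "2 * s\<^sup>2 \<le> F" by simp
  \<comment> \<open>Squaring \<open>eq\<close> gives s^4 - F s^2 + x^2 y^2 = 0, which is the claim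
    expanded.\<close>
  show "(x\<^sup>2 - s\<^sup>2) * (w\<^sup>2 + y\<^sup>2 - s\<^sup>2) = (x * w)\<^sup>2"
    using m n eq F by algebra
qed

theorem proposition4p1:
  fixes \<epsilon> :: real and l1 l2 z :: complex and A :: "quat ^ 2 ^ 2"
  assumes "\<epsilon> > 0"
    and "A = vector [vector [quat_of_complex l1, quat_of_complex z],
                     vector [0, quat_of_complex l2]]"
  shows "pseudo_S_spectrum \<epsilon> ((*v) A) =
    {q. sqrt ((cmod (Q_complex q l1))\<^sup>2 + (cmod (Q_complex q l2))\<^sup>2
              + (cmod ((l1 + l2) * z - 2 * of_real (qRe q) * z))\<^sup>2
              + 2 * cmod (Q_complex q l1) * cmod (Q_complex q l2))
        - sqrt ((cmod (Q_complex q l1))\<^sup>2 + (cmod (Q_complex q l2))\<^sup>2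
              + (cmod ((l1 + l2) * z - 2 * of_real (qRe q) * z))\<^sup>2
              - 2 * cmod (Q_complex q l1) * cmod (Q_complex q l2))
        \<le> 2 * \<epsilon>}"
proof (rule set_eqI)
  fix q
  define a d b where "a = Q_complex q l1" and "d = Q_complex q l2"
    and "b = (l1 + l2) * z - 2 * of_real (qRe q) * z"
  define F where "F = (cmod a)\<^sup>2 + (cmod d)\<^sup>2 + (cmod b)\<^sup>2"
  define s where "s = (sqrt (F + 2 * cmod a * cmod d) - sqrt (F - 2 * cmod a * cmod d)) / 2"
  let ?T = "(*v) (upper_tri (quat_of_complex a) (quat_of_complex b) (quat_of_complex d))"
  have Q: "Q_op q ((*v) A) = ?T"
    using assms(2) by (simp add: Q_op_upper_tri a_def b_def d_def flip: upper_tri_def)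
  have zero: "quat_of_complex w = 0 \<longleftrightarrow> w = 0" for w
    by (metis norm_eq_zero quat_of_complex_hom(4))
  have "q \<in> pseudo_S_spectrum \<epsilon> ((*v) A) \<longleftrightarrow> s \<le> \<epsilon>"
  proof (cases "a = 0 \<or> d = 0")
    \<comment> \<open>Here \<open>q\<close> lies in the S-spectrum, and the two radicands coincide,
      so \<open>s = 0\<close> satisfies the inequality too.\<close>
    case True
    then have "\<not> invertible_op ?T"
      by (intro not_invertible_op_upper_tri) (simp add: zero)
    moreover have "s = 0"
      using True by (auto simp: s_def)
    ultimately show ?thesis
      using assms(1) by (simp add: pseudo_S_spectrum_def S_spectrum_def Q)
  next
    case False
    have sv: "s > 0" "2 * s\<^sup>2 \<le> F"
      "((cmod a)\<^sup>2 - s\<^sup>2) * ((cmod b)\<^sup>2 + (cmod d)\<^sup>2 - s\<^sup>2) = (cmod a * cmod b)\<^sup>2"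
      using False
      by (intro smallest_singular_value[of "cmod a" "cmod d" F "cmod b" s];
          simp add: F_def s_def)+
    have "onorm (inv ?T) = 1 / s"
      using False sv by (intro onorm_inv_upper_tri) (simp_all add: quat_of_complex_hom(4) zero F_def)
    moreover have "invertible_op ?T"
      using False by (intro invertible_op_upper_tri(1)) (simp_all add: zero)
    ultimately have "q \<in> pseudo_S_spectrum \<epsilon> ((*v) A) \<longleftrightarrow> 1 / \<epsilon> \<le> 1 / s"
      by (simp add: pseudo_S_spectrum_def S_spectrum_def Q)
    also have "\<dots> \<longleftrightarrow> s \<le> \<epsilon>"
      using sv(1) assms(1) by (simp add: field_simps)
    finally show ?thesis .
  qed
  also have "\<dots> \<longleftrightarrow>
      sqrt (F + 2 * cmod a * cmod d) - sqrt (F - 2 * cmod a * cmod d) \<le> 2 * \<epsilon>"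
    by (auto simp: s_def)
  finally show "q \<in> pseudo_S_spectrum \<epsilon> ((*v) A) \<longleftrightarrow> q \<in> {q. sqrt ((cmod (Q_complex q l1))\<^sup>2
              + (cmod (Q_complex q l2))\<^sup>2
              + (cmod ((l1 + l2) * z - 2 * of_real (qRe q) * z))\<^sup>2
              + 2 * cmod (Q_complex q l1) * cmod (Q_complex q l2))
        - sqrt ((cmod (Q_complex q l1))\<^sup>2 + (cmod (Q_complex q l2))\<^sup>2
              + (cmod ((l1 + l2) * z - 2 * of_real (qRe q) * z))\<^sup>2
              - 2 * cmod (Q_complex q l1) * cmod (Q_complex q l2))
        \<le> 2 * \<epsilon>}"
    by (simp only: mem_Collect_eq F_def a_def d_def b_def)
qed

end
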